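(* Let $p$ be a prime number and let $I$ be an indecomposable cycle set of size $p^2$, of multipermutational level $2$ and with permutation group $\mathcal{G}(I)$ isomorphic to $\mathbb{Z}/p\mathbb{Z}\times\mathbb{Z}/p\mathbb{Z}$. Let $\alpha$ be a $p$-cycle in $Sym(\mathbb{Z}/p\mathbb{Z})$. Then $I$ is isomorphic to the cycle set $(\mathbb{Z}/p\mathbb{Z}\times\mathbb{Z}/p\mathbb{Z},\cdot_\alpha)$ given by $(a,i)\cdot_\alpha(b,j):=(b+1,\alpha^a(j))$ for all $(a,i),(b,j)\in\mathbb{Z}/p\mathbb{Z}\times\mathbb{Z}/p\mathbb{Z}$.
   Context: A cycle set is a non-empty set $X$ with a binary operation $\cdot$ such that every left multiplication $\sigma_x:X\to X,\ y\mapsto x\cdot y$ is bijective and $(x\cdot y)\cdot(x\cdot z)=(y\cdot x)\cdot(y\cdot z)$ for all $x,y,z\in X$. The permutation group $\mathcal{G}(X)$ is the subgroup of $Sym(X)$ generated by $\{\sigma_x\mid x\in X\}$. $X$ is indecomposable if there is no partition $\{Y,Z\}$ of $X$ into non-empty subsets with $\sigma_x(Y)\subseteq Y$ and $\sigma_x(Z)\subseteq Z$ for all $x\in X$ (equivalently, $\mathcal{G}(X)$ is transitive on $X$). For a non-degenerate cycle set (i.e. $x\mapsto x\cdot x$ is bijective; every finite cycle set is non-degenerate) the retraction is the cycle set $\sigma(X):=\{\sigma_x\mid x\in X\}$ with $\sigma_x\cdot\sigma_y:=\sigma_{x\cdot y}$; one puts $\sigma^0(X):=X$, $\sigma^m(X):=\sigma(\sigma^{m-1}(X))$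 for $m\ge1$. $X$ is multipermutational of level $m$ if $m$ is the minimal non-negative integer with $|\sigma^m(X)|=1$. Since $\alpha$ has order $p$, $\alpha^a$ is well defined for $a\in\mathbb{Z}/p\mathbb{Z}$. *)

theory Defs
  imports
    "HOL-Algebra.Bij"
    "HOL-Algebra.Elementary_Groups"
    "HOL-Combinatorics.Cycles"
    "HOL-Computational_Algebra.Primes"
begin

record 'a cyc = "'a partial_object" +
  dot :: "'a \<Rightarrow> 'a \<Rightarrow> 'a" (infixl \<open>\<cdot>\<index>\<close> 70)

locale cycle_set =
  fixes X :: "('a, 'b) cyc_scheme" (structure)
  assumes nonempty: "carrier X \<noteq> {}"
    and bij: "x \<in> carrier X \<Longrightarrow> bij_betw (\<lambda>y. x \<cdot> y) (carrier X) (carrier X)"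
    and cycle_law: "\<lbrakk>x \<in> carrier X; y \<in> carrier X; z \<in> carrier X\<rbrakk>
      \<Longrightarrow> (x \<cdot> y) \<cdot> (x \<cdot> z) = (y \<cdot> x) \<cdot> (y \<cdot> z)"

text \<open>Left multiplications are restricted to the carrier, so that they are elements of the
  library's symmetric group \<^term>\<open>BijGroup (carrier X)\<close>, and so that equality of left
  multiplications means equality as maps on the carrier.\<close>

definition left_mult :: "('a, 'b) cyc_scheme \<Rightarrow> 'a \<Rightarrow> 'a \<Rightarrow> 'a" where
  "left_mult X x = (\<lambda>y \<in> carrier X. x \<cdot>\<^bsub>X\<^esub> y)"

definition permutation_group :: "('a, 'b) cyc_scheme \<Rightarrow> ('a \<Rightarrow> 'a) monoid" where
  "permutation_group X = subgroup_generated (BijGroup (carrier X)) (left_mult X ` carrier X)"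

definition indecomposable :: "('a, 'b) cyc_scheme \<Rightarrow> bool" where
  "indecomposable X \<longleftrightarrow>
    \<not> (\<exists>Y Z. Y \<noteq> {} \<and> Z \<noteq> {} \<and> Y \<union> Z = carrier X \<and> Y \<inter> Z = {} \<and>
        (\<forall>x \<in> carrier X. left_mult X x ` Y \<subseteq> Y \<and> left_mult X x ` Z \<subseteq> Z))"

text \<open>The operation of the retraction sends the left multiplications by \<open>x\<close> and \<open>y\<close> to the left
  multiplication by \<open>x \<cdot> y\<close>; the lemma \<open>retraction_dot\<close> below shows that this does not
  depend on the choice of \<open>x\<close> and \<open>y\<close>.\<close>

definition retraction :: "('a, 'b) cyc_scheme \<Rightarrow> ('a \<Rightarrow> 'a) cyc" where
  "retraction X =
    \<lparr>carrier = left_mult X ` carrier X,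
     dot = (\<lambda>f g. THE h. \<exists>x \<in> carrier X. \<exists>y \<in> carrier X.
        f = left_mult X x \<and> g = left_mult X y \<and> h = left_mult X (x \<cdot>\<^bsub>X\<^esub> y))\<rparr>"

text \<open>Each retraction lives on a new type, so the iterated retraction is not a function of a
  variable exponent. The following is the definition of multipermutational level \<open>m\<close> (the least
  \<open>m\<close> for which the \<open>m\<close>-th iterated retraction is a singleton) written out for \<open>m = 2\<close>.\<close>

definition multipermutational_level_2 :: "('a, 'b) cyc_scheme \<Rightarrow> bool" where
  "multipermutational_level_2 X \<longleftrightarrow>
    card (carrier (retraction (retraction X))) = 1 \<and>
    card (carrier (retraction X)) \<noteq> 1 \<and>
    card (carrier X) \<noteq> 1"

definition cycle_set_isomorphic ::
    "('a, 'b) cyc_scheme \<Rightarrow> ('c, 'd) cyc_scheme \<Rightarrow> bool" where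
  "cycle_set_isomorphic X Y \<longleftrightarrow>
    (\<exists>f. bij_betw f (carrier X) (carrier Y) \<and>
      (\<forall>x \<in> carrier X. \<forall>y \<in> carrier X. f (x \<cdot>\<^bsub>X\<^esub> y) = f x \<cdot>\<^bsub>Y\<^esub> f y))"

text \<open>The integers modulo \<open>p\<close> are represented by \<open>{0..<int p}\<close>, the carrier of
  \<^term>\<open>integer_mod_group p\<close>. A permutation of this set is a function on \<^typ>\<open>int\<close> that is the
  identity elsewhere, and a power with exponent in the integers modulo \<open>p\<close> is taken with the
  representative in \<open>{0..<int p}\<close>.\<close>

definition p_cycle :: "nat \<Rightarrow> (int \<Rightarrow> int) \<Rightarrow> bool" where
  "p_cycle p \<alpha> \<longleftrightarrow>
    (\<exists>cs. cycle cs \<and> length cs = p \<and> set cs \<subseteq> {0..<int p} \<and> \<alpha> = cycle_of_list cs)"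

definition cycle_set_of_cycle :: "nat \<Rightarrow> (int \<Rightarrow> int) \<Rightarrow> (int \<times> int) cyc" where
  "cycle_set_of_cycle p \<alpha> =
    \<lparr>carrier = {0..<int p} \<times> {0..<int p},
     dot = (\<lambda>(a, i) (b, j). ((b + 1) mod int p, (\<alpha> ^^ nat a) j))\<rparr>"

context cycle_set
begin

lemma dot_closed: "\<lbrakk>x \<in> carrier X; y \<in> carrier X\<rbrakk> \<Longrightarrow> x \<cdot> y \<in> carrier X"
  using bij bij_betwE by blast

lemma left_mult_eq_iff:
  "left_mult X x = left_mult X x' \<longleftrightarrow> (\<forall>z \<in> carrier X. x \<cdot> z = x' \<cdot> z)"
  by (auto simp: left_mult_def restrict_def fun_eq_iff split: if_splits)

lemma left_mult_dot_cong:
  assumes mem: "x \<in> carrier X" "x' \<in> carrier X" "y \<in> carrier X" "y' \<in> carrier X"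
    and eq: "left_mult X x = left_mult X x'" "left_mult X y = left_mult X y'"
  shows "left_mult X (x \<cdot> y) = left_mult X (x' \<cdot> y')"
proof -
  have "(x \<cdot> y) \<cdot> z = (x' \<cdot> y') \<cdot> z" if "z \<in> carrier X" for z
  proof -
    have "z \<in> (\<lambda>w. x \<cdot> w) ` carrier X"
      using bij[OF mem(1)] that by (simp add: bij_betw_imp_surj_on)
    then obtain w where w: "w \<in> carrier X" "z = x \<cdot> w"
      by blast
    have "(x \<cdot> y) \<cdot> z = (y \<cdot> x) \<cdot> (y \<cdot> w)"
      unfolding w(2) using cycle_law[OF mem(1) mem(3) w(1)] .
    also have "\<dots> = (y' \<cdot> x) \<cdot> (y' \<cdot> w)"
      using eq(2) mem(1) w(1) by (simp add: left_mult_eq_iff)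
    also have "\<dots> = (x \<cdot> y') \<cdot> (x \<cdot> w)"
      using cycle_law[OF mem(4) mem(1) w(1)] .
    also have "\<dots> = (x' \<cdot> y') \<cdot> z"
      using eq(1) mem w by (simp add: left_mult_eq_iff)
    finally show ?thesis .
  qed
  then show ?thesis
    by (simp add: left_mult_eq_iff)
qed

lemma retraction_dot:
  assumes "x \<in> carrier X" "y \<in> carrier X"
  shows "left_mult X x \<cdot>\<^bsub>retraction X\<^esub> left_mult X y = left_mult X (x \<cdot> y)"
proof -
  have "(THE h. \<exists>x' \<in> carrier X. \<exists>y' \<in> carrier X. left_mult X x = left_mult X x' \<and>
      left_mult X y = left_mult X y' \<and> h = left_mult X (x' \<cdot> y')) = left_mult X (x \<cdot> y)"
  proof (rule the_equality)
    fix h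
    assume "\<exists>x' \<in> carrier X. \<exists>y' \<in> carrier X. left_mult X x = left_mult X x' \<and>
      left_mult X y = left_mult X y' \<and> h = left_mult X (x' \<cdot> y')"
    then show "h = left_mult X (x \<cdot> y)"
      using left_mult_dot_cong[OF assms(1) _ assms(2)] by metis
  qed (use assms in blast)
  then show ?thesis
    by (simp only: retraction_def cyc.simps)
qed

end

end

theory Submission
  imports Defs
begin

text \<open>All left multiplications of \<open>I\<close> commute and have order dividing \<open>p\<close>, since they lie in a
  group isomorphic to \<open>\<int>/p \<times> \<int>/p\<close>. Level two implies that \<open>\<sigma>\<^bsub>x\<cdot>y\<^esub>\<close> does not depend on \<open>x\<close>. Fix a
  point \<open>e\<close> and put \<open>g = \<sigma>\<^bsub>e\<^esub>\<close>, \<open>h = \<sigma>\<^bsub>e\<cdot>e\<^esub>\<close>. A point obtained from \<open>e\<close> by applying \<open>k\<close> left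
  multiplications, no matter which ones, has a left multiplication that depends on \<open>k\<close> only; call
  it \<open>g\<^sub>k\<close>. The cycle law for the pair \<open>e\<close>, \<open>g\<^sup>k e\<close> reads \<open>g\<^bsub>k+1\<^esub> g = h g\<^sub>k\<close>, so
  \<open>g\<^sub>k = u\<^sup>k g\<close> with \<open>u = h g\<^sup>-\<^sup>1\<close> (lemma \<open>dot_word\<close>).

  Writing \<open>g\<^sup>-\<^sup>1\<close> as \<open>g\<^bsup>p-1\<^esup>\<close>, the point \<open>f (a, i) = g\<^sup>a u\<^sup>i e\<close> is reached by \<open>a + p i\<close> left
  multiplications, and \<open>u\<^sup>p = 1\<close>, so its left multiplication is \<open>u\<^sup>a g\<close>. Hence
  \<open>f (a, i) \<cdot> f (b, j) = f (b + 1, j + a)\<close>. The set of all \<open>f (a, i)\<close> is closed under every left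
  multiplication, so it is all of \<open>I\<close> by indecomposability, and counting shows that \<open>f\<close> is a
  bijection from \<open>\<int>/p \<times> \<int>/p\<close>. So \<open>I\<close> is determined up to isomorphism by \<open>p\<close>. On the other side,
  any \<open>p\<close>-cycle \<open>\<alpha>\<close> is the shift \<open>i \<mapsto> i + 1\<close> after renaming points along the cycle, so the cycle
  set of \<open>\<alpha>\<close> is isomorphic to the same model.\<close>

section \<open>The cycle set of the shift\<close>

definition shift_cycle_set :: "nat \<Rightarrow> (nat \<times> nat) cyc" where
  "shift_cycle_set p =
    \<lparr>carrier = {..<p} \<times> {..<p},
     dot = (\<lambda>(a, i) (b, j). ((b + 1) mod p, (j + a) mod p))\<rparr>"

lemma cycle_set_isomorphic_common_source:
  assumes "cycle_set_isomorphic S X" "cycle_set_isomorphic S Y"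
    and closed: "\<And>s t. \<lbrakk>s \<in> carrier S; t \<in> carrier S\<rbrakk> \<Longrightarrow> s \<cdot>\<^bsub>S\<^esub> t \<in> carrier S"
  shows "cycle_set_isomorphic X Y"
proof -
  obtain f where f: "bij_betw f (carrier S) (carrier X)"
      "\<And>s t. \<lbrakk>s \<in> carrier S; t \<in> carrier S\<rbrakk> \<Longrightarrow> f (s \<cdot>\<^bsub>S\<^esub> t) = f s \<cdot>\<^bsub>X\<^esub> f t"
    using assms(1) unfolding cycle_set_isomorphic_def by blast
  obtain g where g: "bij_betw g (carrier S) (carrier Y)"
      "\<And>s t. \<lbrakk>s \<in> carrier S; t \<in> carrier S\<rbrakk> \<Longrightarrow> g (s \<cdot>\<^bsub>S\<^esub> t) = g s \<cdot>\<^bsub>Y\<^esub> g t"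
    using assms(2) unfolding cycle_set_isomorphic_def by blast
  let ?k = "g \<circ> the_inv_into (carrier S) f"
  have inj: "inj_on f (carrier S)" and surj: "f ` carrier S = carrier X"
    using f(1) by (auto simp: bij_betw_def)
  have k: "?k (f s) = g s" if "s \<in> carrier S" for s
    using that inj by (simp add: the_inv_into_f_f)
  have "bij_betw ?k (carrier X) (carrier Y)"
    using bij_betw_trans[OF bij_betw_the_inv_into[OF f(1)] g(1)] .
  moreover have "?k (x \<cdot>\<^bsub>X\<^esub> y) = ?k x \<cdot>\<^bsub>Y\<^esub> ?k y" if x: "x \<in> carrier X" and y: "y \<in> carrier X" for x y
  proof -
    obtain s t where st: "s \<in> carrier S" "t \<in> carrier S" "x = f s" "y = f t"
      using x y unfolding surj[symmetric] by blast
    then have "?k (x \<cdot>\<^bsub>X\<^esub> y) = ?k (f (s \<cdot>\<^bsub>S\<^esub> t))"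
      by (simp only: f(2))
    also have "\<dots> = g s \<cdot>\<^bsub>Y\<^esub> g t"
      using st closed by (simp only: k g(2))
    also have "\<dots> = ?k x \<cdot>\<^bsub>Y\<^esub> ?k y"
      unfolding st(3,4) k[OF st(1)] k[OF st(2)] ..
    finally show ?thesis .
  qed
  ultimately show ?thesis
    unfolding cycle_set_isomorphic_def by blast
qed

text \<open>Numbering the points along the cycle turns a \<open>p\<close>-cycle into the shift.\<close>

lemma shift_cycle_set_isomorphic_cycle_set_of_cycle:
  assumes "p_cycle p \<alpha>"
  shows "cycle_set_isomorphic (shift_cycle_set p) (cycle_set_of_cycle p \<alpha>)"
proof -
  obtain cs where cs: "distinct cs" "length cs = p" "set cs \<subseteq> {0..<int p}" "\<alpha> = cycle_of_list cs"
    using assms unfolding p_cycle_def by auto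
  have "card (set cs) = card {0..<int p}"
    using cs by (simp add: distinct_card)
  then have "set cs = {0..<int p}"
    using cs(3) by (simp add: card_subset_eq)
  then have nth: "bij_betw ((!) cs) {..<p} {0..<int p}"
    using cs by (intro bij_betw_nth) auto
  have int: "bij_betw int {..<p} {0..<int p}"
    by (auto simp: bij_betw_def inj_on_def image_int_atLeastLessThan[of 0, simplified]
        atLeast0LessThan[symmetric])
  have pow: "(\<alpha> ^^ a) (cs ! i) = cs ! ((i + a) mod p)" if "i < p" for a i
  proof -
    have "(\<alpha> ^^ a) (cs ! i) = map (\<alpha> ^^ a) cs ! i"
      using that cs by simp
    also have "\<dots> = cs ! ((i + a) mod p)"
      using that cs by (simp add: cyclic_rotation nth_rotate add.commute)
    finally show ?thesis .
  qed
  let ?f = "map_prod int ((!) cs)"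
  have "bij_betw ?f (carrier (shift_cycle_set p)) (carrier (cycle_set_of_cycle p \<alpha>))"
    unfolding shift_cycle_set_def cycle_set_of_cycle_def using bij_betw_map_prod[OF int nth] by simp
  moreover have "?f (s \<cdot>\<^bsub>shift_cycle_set p\<^esub> t) = ?f s \<cdot>\<^bsub>cycle_set_of_cycle p \<alpha>\<^esub> ?f t"
    if "s \<in> carrier (shift_cycle_set p)" "t \<in> carrier (shift_cycle_set p)" for s t
    using that pow
    by (auto simp: shift_cycle_set_def cycle_set_of_cycle_def of_nat_mod add.commute)
  ultimately show ?thesis
    unfolding cycle_set_isomorphic_def by blast
qed

section \<open>Commuting left multiplications of exponent p\<close>

lemma DirProd_pow:
  "(x, y) [^]\<^bsub>G \<times>\<times> H\<^esub> (n::nat) = (x [^]\<^bsub>G\<^esub> n, y [^]\<^bsub>H\<^esub> n)"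
  by (induction n) auto

lemma BijGroup_mult_apply:
  "\<lbrakk>f \<in> Bij S; g \<in> Bij S; z \<in> S\<rbrakk> \<Longrightarrow> (f \<otimes>\<^bsub>BijGroup S\<^esub> g) z = f (g z)"
  by (simp add: BijGroup_def compose_def)

lemma BijGroup_pow_apply:
  assumes "f \<in> Bij S" "z \<in> S"
  shows "(f [^]\<^bsub>BijGroup S\<^esub> (n::nat)) z = (f ^^ n) z"
  using assms(2)
proof (induction n arbitrary: z)
  case 0
  then show ?case by (simp add: BijGroup_def)
next
  case (Suc n)
  interpret G: group "BijGroup S" by (rule group_BijGroup)
  have f: "f \<in> carrier (BijGroup S)"
    using assms by (simp add: BijGroup_def)
  then have "f [^]\<^bsub>BijGroup S\<^esub> n \<in> Bij S"
    using G.nat_pow_closed[OF f] by (simp add: BijGroup_def)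
  moreover have "f z \<in> S"
    using assms(1) Suc.prems Bij_imp_funcset by blast
  ultimately have "(f [^]\<^bsub>BijGroup S\<^esub> Suc n) z = (f [^]\<^bsub>BijGroup S\<^esub> n) (f z)"
    using assms(1) Suc.prems by (simp add: BijGroup_mult_apply)
  also have "\<dots> = (f ^^ n) (f z)"
    using Suc.IH \<open>f z \<in> S\<close> .
  finally show ?case
    by (simp only: funpow_Suc_right comp_apply)
qed

context cycle_set
begin

lemma left_mult_in_Bij: "x \<in> carrier X \<Longrightarrow> left_mult X x \<in> Bij (carrier X)"
  using bij by (simp add: left_mult_def Bij_def bij_betw_restrict_eq)

lemma left_mult_in_permutation_group:
  assumes "x \<in> carrier X"
  shows "left_mult X x \<in> carrier (permutation_group X)"
  using assms left_mult_in_Bij unfolding permutation_group_def carrier_subgroup_generated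
  by (intro generate.incl) (auto simp: BijGroup_def)

lemma group_permutation_group: "group (permutation_group X)"
  unfolding permutation_group_def by (rule group.group_subgroup_generated[OF group_BijGroup])

text \<open>Two properties of \<open>\<int>/p \<times> \<int>/p\<close> pass through the isomorphism: commutativity and exponent
  \<open>p\<close>.\<close>

lemma elementary_abelian_permutation_group:
  assumes "permutation_group X \<cong> integer_mod_group p \<times>\<times> integer_mod_group p"
    and "f \<in> carrier (permutation_group X)" "g \<in> carrier (permutation_group X)"
  shows "f \<otimes>\<^bsub>permutation_group X\<^esub> g = g \<otimes>\<^bsub>permutation_group X\<^esub> f"
    and "f [^]\<^bsub>permutation_group X\<^esub> p = \<one>\<^bsub>permutation_group X\<^esub>"
proof -
  let ?G = "permutation_group X" and ?H = "integer_mod_group p \<times>\<times> integer_mod_group p"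
  obtain \<phi> where "\<phi> \<in> iso ?G ?H"
    using assms(1) unfolding is_iso_def by blast
  then have hom: "\<phi> \<in> hom ?G ?H" and inj: "inj_on \<phi> (carrier ?G)"
    by (auto simp: iso_def bij_betw_def)
  interpret G: group ?G by (rule group_permutation_group)
  interpret H: group ?H by (intro DirProd_group group_integer_mod_group)
  have "\<phi> (f \<otimes>\<^bsub>?G\<^esub> g) = \<phi> (g \<otimes>\<^bsub>?G\<^esub> f)"
    using assms hom by (simp add: hom_mult mult_DirProd' add.commute)
  then show "f \<otimes>\<^bsub>?G\<^esub> g = g \<otimes>\<^bsub>?G\<^esub> f"
    using inj assms by (simp add: inj_on_eq_iff)
  have "\<phi> (f [^]\<^bsub>?G\<^esub> p) = \<phi> f [^]\<^bsub>?H\<^esub> p"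
    using hom_nat_pow[OF hom assms(2) G.is_group H.is_group] .
  also have "\<dots> = \<one>\<^bsub>?H\<^esub>"
    by (cases "\<phi> f") (simp add: DirProd_pow)
  also have "\<dots> = \<phi> \<one>\<^bsub>?G\<^esub>"
    using hom by (simp add: hom_one G.is_group H.is_group del: one_DirProd)
  finally show "f [^]\<^bsub>?G\<^esub> p = \<one>\<^bsub>?G\<^esub>"
    using inj assms by (simp add: inj_on_eq_iff)
qed

lemma dot_commute_if_elementary_abelian:
  assumes "permutation_group X \<cong> integer_mod_group p \<times>\<times> integer_mod_group p"
    and "x \<in> carrier X" "y \<in> carrier X" "z \<in> carrier X"
  shows "x \<cdot> (y \<cdot> z) = y \<cdot> (x \<cdot> z)"
proof -
  have "compose (carrier X) (left_mult X x) (left_mult X y)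
      = compose (carrier X) (left_mult X y) (left_mult X x)"
    using elementary_abelian_permutation_group(1)[OF assms(1)
        left_mult_in_permutation_group[OF assms(2)] left_mult_in_permutation_group[OF assms(3)]]
    by (simp add: permutation_group_def BijGroup_def left_mult_in_Bij assms)
  from fun_cong[OF this, of z] show ?thesis
    using assms by (simp add: compose_def left_mult_def dot_closed)
qed

lemma funpow_dot_closed:
  "\<lbrakk>x \<in> carrier X; z \<in> carrier X\<rbrakk> \<Longrightarrow> ((\<lambda>y. x \<cdot> y) ^^ n) z \<in> carrier X"
  by (induction n) (auto intro: dot_closed)

lemma dot_exponent_if_elementary_abelian:
  assumes "permutation_group X \<cong> integer_mod_group p \<times>\<times> integer_mod_group p"
    and "x \<in> carrier X" "z \<in> carrier X"
  shows "((\<lambda>y. x \<cdot> y) ^^ p) z = z"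
proof -
  have "left_mult X x [^]\<^bsub>BijGroup (carrier X)\<^esub> p = \<one>\<^bsub>BijGroup (carrier X)\<^esub>"
    using elementary_abelian_permutation_group(2)[OF assms(1)
        left_mult_in_permutation_group[OF assms(2)] left_mult_in_permutation_group[OF assms(2)]]
    by (simp add: permutation_group_def nat_pow_def)
  from fun_cong[OF this, of z] have "(left_mult X x ^^ p) z = z"
    using assms by (simp add: BijGroup_pow_apply left_mult_in_Bij) (simp add: BijGroup_def)
  moreover have "(left_mult X x ^^ n) z = ((\<lambda>y. x \<cdot> y) ^^ n) z" for n
    using assms(2,3) by (induction n) (auto simp: left_mult_def funpow_dot_closed)
  ultimately show ?thesis by simp
qed

text \<open>A one-point second retraction means that all left multiplications of the retraction agree.\<close>

lemma left_mult_dot_eq_if_level_2: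
  assumes "multipermutational_level_2 X"
    and "x \<in> carrier X" "x' \<in> carrier X" "y \<in> carrier X"
  shows "left_mult X (x \<cdot> y) = left_mult X (x' \<cdot> y)"
proof -
  let ?R = "retraction X"
  have R: "left_mult X z \<in> carrier ?R" if "z \<in> carrier X" for z
    using that by (simp add: retraction_def)
  have "card (left_mult ?R ` carrier ?R) = 1"
    using assms(1) by (simp add: multipermutational_level_2_def retraction_def[of ?R])
  then have "left_mult ?R (left_mult X x) = left_mult ?R (left_mult X x')"
    using R[OF assms(2)] R[OF assms(3)] by (metis card_1_singletonE imageI singletonD)
  from fun_cong[OF this, of "left_mult X y"] show ?thesis
    using R assms by (simp add: left_mult_def[of ?R] retraction_dot)
qed

text \<open>By finiteness an invariant set has an invariant complement.\<close>

lemma indecomposable_invariant_eq_carrier: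
  assumes "indecomposable X" "finite (carrier X)" "A \<subseteq> carrier X" "A \<noteq> {}"
    and inv: "\<And>x y. \<lbrakk>x \<in> carrier X; y \<in> A\<rbrakk> \<Longrightarrow> x \<cdot> y \<in> A"
  shows "A = carrier X"
proof (rule ccontr)
  assume "A \<noteq> carrier X"
  have "left_mult X x ` A \<subseteq> A" if "x \<in> carrier X" for x
    using that inv assms(3) by (auto simp: left_mult_def)
  moreover have "left_mult X x ` (carrier X - A) \<subseteq> carrier X - A" if x: "x \<in> carrier X" for x
  proof -
    have inj: "inj_on (\<lambda>y. x \<cdot> y) (carrier X)"
      using bij[OF x] by (simp add: bij_betw_def)
    then have "(\<lambda>y. x \<cdot> y) ` A = A"
      using inv[OF x] assms(2,3)
      by (intro card_subset_eq card_image) (auto intro: finite_subset inj_on_subset)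
    then show ?thesis
      using inj assms(3) dot_closed[OF x]
      by (auto simp: left_mult_def inj_on_def)
  qed
  moreover have "carrier X - A \<noteq> {}" "A \<union> (carrier X - A) = carrier X" "A \<inter> (carrier X - A) = {}"
    using assms(3) \<open>A \<noteq> carrier X\<close> by auto
  ultimately have "\<not> indecomposable X"
    using \<open>A \<noteq> {}\<close> unfolding indecomposable_def not_not
    by (intro exI[of _ A] exI[of _ "carrier X - A"]) simp
  then show False
    using assms(1) by contradiction
qed

end

section \<open>Coordinates\<close>

locale level_2_exponent_cycle_set = cycle_set X
  for X :: "('a, 'b) cyc_scheme" (structure) +
  fixes p :: nat and e :: 'a
  assumes p_pos: "0 < p"
    and e: "e \<in> carrier X"
    and commute: "\<lbrakk>x \<in> carrier X; y \<in> carrier X; z \<in> carrier X\<rbrakk> \<Longrightarrow> x \<cdot> (y \<cdot> z) = y \<cdot> (x \<cdot> z)"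
    and exponent: "\<lbrakk>x \<in> carrier X; z \<in> carrier X\<rbrakk> \<Longrightarrow> ((\<lambda>y. x \<cdot> y) ^^ p) z = z"
    and level: "\<lbrakk>x \<in> carrier X; x' \<in> carrier X; y \<in> carrier X\<rbrakk>
      \<Longrightarrow> left_mult X (x \<cdot> y) = left_mult X (x' \<cdot> y)"
begin

text \<open>The products \<open>g\<^sup>m h\<^sup>n e\<close>, where \<open>g\<close> and \<open>h\<close> are the left multiplications by \<open>e\<close> and \<open>e \<cdot> e\<close>.\<close>

definition word :: "nat \<Rightarrow> nat \<Rightarrow> 'a" where
  "word m n = ((\<lambda>y. e \<cdot> y) ^^ m) (((\<lambda>y. (e \<cdot> e) \<cdot> y) ^^ n) e)"

lemma word_closed: "word m n \<in> carrier X"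
  unfolding word_def by (intro funpow_dot_closed dot_closed e)

lemma dot_word_fst: "e \<cdot> word m n = word (Suc m) n"
  by (simp add: word_def)

lemma dot_word_snd: "(e \<cdot> e) \<cdot> word m n = word m (Suc n)"
proof (induction m)
  case (Suc m)
  have "(e \<cdot> e) \<cdot> word (Suc m) n = e \<cdot> ((e \<cdot> e) \<cdot> word m n)"
    by (simp add: dot_word_fst[symmetric] commute e dot_closed word_closed)
  then show ?case
    using Suc by (simp add: dot_word_fst)
qed (simp add: word_def)

lemma funpow_dot_word: "((\<lambda>y. e \<cdot> y) ^^ k) (word m n) = word (k + m) n"
  by (induction k) (simp_all add: dot_word_fst)

lemma word_mod: "word (m mod p) (n mod p) = word m n"
proof -
  have fst: "word (m + k * p) n = word m n" for m k n
  proof (induction k)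
    case (Suc k)
    have "word (m + Suc k * p) n = ((\<lambda>y. e \<cdot> y) ^^ p) (word (m + k * p) n)"
      by (simp add: funpow_dot_word ac_simps)
    then show ?case
      using Suc by (simp add: exponent e word_closed)
  qed simp
  have add: "((\<lambda>y. (e \<cdot> e) \<cdot> y) ^^ k) (word m n) = word m (k + n)" for k m n
    by (induction k) (simp_all add: dot_word_snd)
  have snd: "word m (n + k * p) = word m n" for m k n
  proof (induction k)
    case (Suc k)
    have "word m (n + Suc k * p) = ((\<lambda>y. (e \<cdot> e) \<cdot> y) ^^ p) (word m (n + k * p))"
      by (simp add: add ac_simps)
    then show ?case
      using Suc by (simp add: exponent e word_closed dot_closed)
  qed simp
  have "word m n = word (m mod p + (m div p) * p) (n mod p + (n div p) * p)"
    by simp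
  then show ?thesis
    unfolding fst snd by simp
qed

text \<open>The left multiplication by \<open>word k 0\<close> is \<open>g\<^sub>k\<close>. By level two \<open>x\<close> may be replaced by \<open>e\<close> in
  \<open>x \<cdot> y\<close>, so each further left multiplication raises the index by one.\<close>

lemma left_mult_word_dot:
  assumes "x \<in> carrier X" "y \<in> carrier X" "left_mult X y = left_mult X (word k 0)"
  shows "left_mult X (x \<cdot> y) = left_mult X (word (Suc k) 0)"
proof -
  have "left_mult X (x \<cdot> y) = left_mult X (e \<cdot> y)"
    using assms e by (intro level)
  also have "\<dots> = left_mult X (e \<cdot> word k 0)"
    using assms e word_closed by (intro left_mult_dot_cong) auto
  finally show ?thesis
    by (simp add: dot_word_fst)
qed

lemma left_mult_word: "left_mult X (word m n) = left_mult X (word (m + n) 0)"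
proof (induction m)
  case 0
  show ?case
  proof (induction n)
    case (Suc n)
    then show ?case
      using left_mult_word_dot[of "e \<cdot> e" "word 0 n" n] by (simp add: dot_word_snd e word_closed dot_closed)
  qed simp
next
  case (Suc m)
  then show ?case
    using left_mult_word_dot[of e "word m n" "m + n"] by (simp add: dot_word_fst e word_closed)
qed

text \<open>The recurrence \<open>g g\<^bsub>k+1\<^esub> = h g\<^sub>k\<close> is the cycle law, with commutativity and level two used to
  simplify both sides.\<close>

lemma dot_word_Suc:
  assumes "z \<in> carrier X"
  shows "e \<cdot> (word (Suc k) 0 \<cdot> z) = (e \<cdot> e) \<cdot> (word k 0 \<cdot> z)"
proof -
  have "e \<cdot> (word (Suc k) 0 \<cdot> z) = (e \<cdot> word k 0) \<cdot> (e \<cdot> z)"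
    using assms by (simp add: commute e word_closed dot_word_fst)
  also have "\<dots> = (word k 0 \<cdot> e) \<cdot> (word k 0 \<cdot> z)"
    using assms by (simp add: cycle_law e word_closed)
  also have "\<dots> = (e \<cdot> e) \<cdot> (word k 0 \<cdot> z)"
    using level[of "word k 0" e e] assms e word_closed by (auto simp: left_mult_eq_iff dot_closed)
  finally show ?thesis .
qed

text \<open>This is \<open>g\<^sub>k = (h g\<^sup>-\<^sup>1)\<^sup>k g\<close>, with \<open>g\<^bsup>p-1\<^esup>\<close> in place of the inverse.\<close>

lemma dot_word: "word k 0 \<cdot> word m n = word (Suc m + (p - 1) * k) (n + k)"
proof (induction k)
  case 0
  have "word 0 0 = e" by (simp add: word_def)
  then show ?case by (simp add: dot_word_fst)
next
  case (Suc k)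
  let ?z = "word (Suc k) 0 \<cdot> word m n"
  have z: "?z \<in> carrier X"
    by (intro dot_closed word_closed)
  have "?z = ((\<lambda>y. e \<cdot> y) ^^ p) ?z"
    by (simp add: exponent e z)
  also have "\<dots> = ((\<lambda>y. e \<cdot> y) ^^ (p - 1)) (e \<cdot> ?z)"
    using p_pos by (cases p) (simp_all add: funpow_Suc_right del: funpow.simps)
  also have "e \<cdot> ?z = word (Suc m + (p - 1) * k) (n + Suc k)"
    by (simp add: dot_word_Suc word_closed Suc.IH dot_word_snd)
  also have "((\<lambda>y. e \<cdot> y) ^^ (p - 1)) \<dots> = word (Suc m + (p - 1) * Suc k) (n + Suc k)"
    by (simp add: funpow_dot_word add_ac)
  finally show ?case .
qed

text \<open>The point \<open>g\<^sup>a u\<^sup>i e\<close> with \<open>u = h g\<^bsup>p-1\<^esup>\<close>.\<close>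

definition point :: "nat \<times> nat \<Rightarrow> 'a" where
  "point = (\<lambda>(a, i). word (a + (p - 1) * i) i)"

lemma point_closed: "point s \<in> carrier X"
  by (simp add: point_def word_closed split: prod.split)

lemma point_mod: "point (a mod p, i mod p) = point (a, i)"
proof -
  have "word (a mod p + (p - 1) * (i mod p)) (i mod p)
      = word ((a mod p + (p - 1) * (i mod p)) mod p) ((i mod p) mod p)"
    by (rule word_mod[symmetric])
  also have "\<dots> = word ((a + (p - 1) * i) mod p) (i mod p)"
    by (intro arg_cong2[where f = word] refl mod_add_cong mod_mult_cong) simp_all
  finally show ?thesis
    by (simp add: point_def word_mod)
qed

lemma word_dot_point: "word k 0 \<cdot> point (b, j) = point (b + 1, j + k)"
  by (simp add: point_def dot_word add_mult_distrib2 add_ac)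

text \<open>The point with coordinates \<open>(a, i)\<close> is reached from \<open>e\<close> by \<open>a + p i\<close> left multiplications, and
  \<open>p i\<close> disappears modulo \<open>p\<close>.\<close>

lemma point_dot_point: "point (a, i) \<cdot> point (b, j) = point ((b + 1) mod p, (j + a) mod p)"
proof -
  have length: "a + (p - 1) * i + i = a + i * p"
    using p_pos by (cases p) (simp_all add: algebra_simps)
  have "left_mult X (point (a, i)) = left_mult X (word (a + i * p) 0)"
    using left_mult_word[of "a + (p - 1) * i" i] unfolding length by (simp add: point_def)
  then have "point (a, i) \<cdot> point (b, j) = word (a + i * p) 0 \<cdot> point (b, j)"
    by (simp add: left_mult_eq_iff point_closed)
  also have "\<dots> = point ((b + 1) mod p, (j + (a + i * p)) mod p)"
    by (simp only: word_dot_point point_mod)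
  also have "(j + (a + i * p)) mod p = (j + a) mod p"
    by (simp add: add.assoc[symmetric])
  finally show ?thesis .
qed

text \<open>Indecomposability is applied twice: the points whose left multiplication is some \<open>g\<^sub>k\<close> form an
  invariant set, so every left multiplication is some \<open>g\<^sub>k\<close>; therefore the points \<open>point (a, i)\<close>
  form an invariant set as well.\<close>

lemma range_point:
  assumes "indecomposable X" "finite (carrier X)"
  shows "point ` ({..<p} \<times> {..<p}) = carrier X"
proof -
  let ?A = "{x \<in> carrier X. \<exists>k. left_mult X x = left_mult X (word k 0)}"
  have "?A = carrier X"
  proof (rule indecomposable_invariant_eq_carrier[OF assms])
    show "?A \<noteq> {}" using word_closed by blast
    show "x \<cdot> y \<in> ?A" if "x \<in> carrier X" "y \<in> ?A" for x y
      using that left_mult_word_dot by (blast intro: dot_closed)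
  qed auto
  then have all: "\<exists>k. \<forall>z \<in> carrier X. x \<cdot> z = word k 0 \<cdot> z" if "x \<in> carrier X" for x
    using that by (auto simp: left_mult_eq_iff)
  have "range point = carrier X"
  proof (rule indecomposable_invariant_eq_carrier[OF assms])
    show "range point \<subseteq> carrier X" using point_closed by blast
    fix x y assume x: "x \<in> carrier X" and "y \<in> range point"
    then obtain b j where y: "y = point (b, j)" by auto
    obtain k where "x \<cdot> y = word k 0 \<cdot> y"
      using all[OF x] y point_closed by blast
    then show "x \<cdot> y \<in> range point"
      by (simp add: y word_dot_point)
  qed simp
  moreover have "range point = point ` ({..<p} \<times> {..<p})"
  proof -
    have "point s \<in> point ` ({..<p} \<times> {..<p})" for s
    proof -
      have "point s = point (fst s mod p, snd s mod p)"
        by (simp add: point_mod)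
      then show ?thesis
        using p_pos by auto
    qed
    then show ?thesis by auto
  qed
  ultimately show ?thesis by simp
qed

lemma shift_cycle_set_isomorphic:
  assumes "indecomposable X" "card (carrier X) = p ^ 2"
  shows "cycle_set_isomorphic (shift_cycle_set p) X"
proof -
  have "finite (carrier X)"
    using assms(2) p_pos by (intro card_ge_0_finite) simp
  then have image: "point ` ({..<p} \<times> {..<p}) = carrier X"
    using assms(1) by (intro range_point)
  then have "inj_on point ({..<p} \<times> {..<p})"
    using assms(2) by (intro eq_card_imp_inj_on) (simp_all add: power2_eq_square)
  then have "bij_betw point (carrier (shift_cycle_set p)) (carrier X)"
    using image by (simp add: bij_betw_def shift_cycle_set_def)
  moreover have "point (s \<cdot>\<^bsub>shift_cycle_set p\<^esub> t) = point s \<cdot> point t" for s t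
    by (cases s; cases t) (simp add: shift_cycle_set_def point_dot_point)
  ultimately show ?thesis
    unfolding cycle_set_isomorphic_def by blast
qed

end

theorem proposition18:
  fixes p :: nat and I :: "'a cyc" and \<alpha> :: "int \<Rightarrow> int"
  assumes "prime p"
    and "cycle_set I"
    and "indecomposable I"
    and "card (carrier I) = p ^ 2"
    and "multipermutational_level_2 I"
    and "permutation_group I \<cong> integer_mod_group p \<times>\<times> integer_mod_group p"
    and "p_cycle p \<alpha>"
  shows "cycle_set_isomorphic I (cycle_set_of_cycle p \<alpha>)"
proof -
  interpret I: cycle_set I by fact
  obtain e where e: "e \<in> carrier I"
    using I.nonempty by blast
  have p: "0 < p"
    using assms(1) by (rule prime_gt_0_nat)
  interpret I: level_2_exponent_cycle_set I p e
    using p e I.dot_commute_if_elementary_abelian[OF assms(6)]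
      I.dot_exponent_if_elementary_abelian[OF assms(6)] I.left_mult_dot_eq_if_level_2[OF assms(5)]
    by unfold_locales
  show ?thesis
  proof (rule cycle_set_isomorphic_common_source)
    show "cycle_set_isomorphic (shift_cycle_set p) I"
      using assms(3,4) by (rule I.shift_cycle_set_isomorphic)
    show "cycle_set_isomorphic (shift_cycle_set p) (cycle_set_of_cycle p \<alpha>)"
      using assms(7) by (rule shift_cycle_set_isomorphic_cycle_set_of_cycle)
    show "s \<cdot>\<^bsub>shift_cycle_set p\<^esub> t \<in> carrier (shift_cycle_set p)"
      if "s \<in> carrier (shift_cycle_set p)" "t \<in> carrier (shift_cycle_set p)" for s t
      using that p by (auto simp: shift_cycle_set_def)
  qed
qed

end
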